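(* Let $\mathcal{O}=\mathcal{O}_{-\mathbb{J}}\subset\mathfrak{sp}(2n,\mathbb{R})$ be the adjoint orbit of $\mathrm{Sp}(2n,\mathbb{R})$ through $-\mathbb{J}$, with its Kostant–Kirillov–Souriau symplectic form $\Omega^+_{\mathcal{O}}$, and identify $\mathcal{O}$ with the Siegel upper half plane $\Sigma_n$ through the upper half plane coordinate $\eta\mapsto W_\eta$. Under this identification, $$\Omega^+_{\mathcal{O}}=\tfrac12\,\Omega_{\Sigma_n},$$ where $\Omega_{\Sigma_n}=\operatorname{Tr}\left(\mathcal{B}^{-1}d\mathcal{A}\otimes\mathcal{B}^{-1}d\mathcal{B}-\mathcal{B}^{-1}d\mathcal{B}\otimes\mathcal{B}^{-1}d\mathcal{A}\right)$ with $\mathcal{A}=\operatorname{Re}W$, $\mathcal{B}=\operatorname{Im}W$.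
   Context: $\mathbb{J}=\begin{bmatrix}0_n & I_n\\ -I_n & 0_n\end{bmatrix}$; $\mathrm{Sp}(2n,\mathbb{R})=\{S : S^\top\mathbb{J}S=\mathbb{J}\}$ with Lie algebra $\mathfrak{sp}(2n,\mathbb{R})$. The trace form is $\langle\langle\xi,\zeta\rangle\rangle=\frac12\operatorname{Tr}(\xi\zeta)$ and $(\Omega^+_{\mathcal{O}})_\eta(\mathrm{ad}_\xi\eta,\mathrm{ad}_\zeta\eta)=\langle\langle\eta,[\xi,\zeta]\rangle\rangle$ for $\eta\in\mathcal{O}$, $\xi,\zeta\in\mathfrak{sp}(2n,\mathbb{R})$, where $\mathrm{ad}_\xi\eta=[\xi,\eta]$. The Siegel upper half plane is $\Sigma_n=\{W\in\mathrm{M}_n(\mathbb{C}) : W^\top=W,\ \operatorname{Im}W>0\}$. The upper half plane coordinate is the bijection $\mathcal{O}\to\Sigma_n$, $\eta\mapsto W_\eta$, such that the $(-i)$-eigenspace of $\eta$ in $\mathbb{C}^{2n}$ is $\left\{\begin{bmatrix}x\\ W_\eta x\end{bmatrix} : x\in\mathbb{C}^n\right\}$. (In particular $W_{-\mathbb{J}}=iI$, and $W_{S\eta S^{-1}}=(C+DW_\eta)(A+BW_\eta)^{-1}$ for $S=\begin{bmatrix}A&B\\C&D\end{bmatrix}\in\mathrm{Sp}(2n,\mathbb{R})$.) *)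

theory Defs
  imports "HOL-Analysis.Analysis"
begin

text \<open>The integer \<open>n\<close> is the cardinality of the index type \<open>'n\<close>; vectors of length \<open>2n\<close> are indexed by
  \<open>'n + 'n\<close>.\<close>

definition vec_join :: "'a^'n \<Rightarrow> 'a^'n \<Rightarrow> 'a^('n::finite + 'n)" where
  "vec_join x y = (\<chi> i. case i of Inl k \<Rightarrow> x $ k | Inr k \<Rightarrow> y $ k)"

definition block_matrix ::
  "'a^'n^'n \<Rightarrow> 'a^'n^'n \<Rightarrow> 'a^'n^'n \<Rightarrow> 'a^'n^'n \<Rightarrow> 'a^('n::finite + 'n)^('n + 'n)" where
  "block_matrix A B C D =
    (\<chi> i. case i of Inl k \<Rightarrow> vec_join (A $ k) (B $ k) | Inr k \<Rightarrow> vec_join (C $ k) (D $ k))"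

definition symp_J :: "real^('n::finite + 'n)^('n + 'n)" where
  "symp_J = block_matrix 0 (mat 1) (- mat 1) 0"

definition Sp :: "(real^('n::finite + 'n)^('n + 'n)) set" where
  "Sp = {S. transpose S ** symp_J ** S = symp_J}"

definition sp :: "(real^('n::finite + 'n)^('n + 'n)) set" where
  "sp = {\<xi>. transpose \<xi> ** symp_J + symp_J ** \<xi> = 0}"

definition commutator :: "real^'m^'m \<Rightarrow> real^'m^'m \<Rightarrow> real^'m^'m" where
  "commutator A B = A ** B - B ** A"

definition trace_form :: "real^'m^'m \<Rightarrow> real^'m^'m \<Rightarrow> real" where
  "trace_form \<xi> \<zeta> = 1/2 * trace (\<xi> ** \<zeta>)"

definition orbit :: "(real^('n::finite + 'n)^('n + 'n)) set" where
  "orbit = {S ** (- symp_J) ** matrix_inv S | S. S \<in> Sp}"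

definition orbit_tangent :: "real^('n::finite + 'n)^('n + 'n) \<Rightarrow> (real^('n + 'n)^('n + 'n)) set" where
  "orbit_tangent \<eta> = {commutator \<xi> \<eta> | \<xi>. \<xi> \<in> sp}"

text \<open>The Kostant--Kirillov--Souriau form at \<open>\<eta>\<close>, as a function of two tangent vectors. Its value does
  not depend on the choice of \<open>\<xi>\<close> and \<open>\<zeta>\<close>: see \<open>kks_form_commutator\<close> below.\<close>

definition kks_form ::
  "real^('n::finite + 'n)^('n + 'n) \<Rightarrow> real^('n + 'n)^('n + 'n) \<Rightarrow> real^('n + 'n)^('n + 'n) \<Rightarrow> real" where
  "kks_form \<eta> X Y = (THE c. \<exists>\<xi>\<in>sp. \<exists>\<zeta>\<in>sp. X = commutator \<xi> \<eta> \<and> Y = commutator \<zeta> \<eta> \<and>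
     c = trace_form \<eta> (commutator \<xi> \<zeta>))"

lemma matrix_diff_ldistrib: "A ** (B - C) = A ** B - A ** (C :: real^'m^'m)"
  by (simp add: matrix_matrix_mult_def vec_eq_iff right_diff_distrib sum_subtractf)

lemma matrix_diff_rdistrib: "(A - B) ** C = A ** C - B ** (C :: real^'m^'m)"
  by (simp add: matrix_matrix_mult_def vec_eq_iff left_diff_distrib sum_subtractf)

lemma trace_form_commutator_left:
  "trace_form \<eta> (commutator \<xi> \<zeta>) = - trace_form (commutator \<xi> \<eta>) \<zeta>"
proof -
  have "trace (\<eta> ** (\<zeta> ** \<xi>)) = trace (\<xi> ** \<eta> ** \<zeta>)"
    by (metis trace_mul_sym matrix_mul_assoc)
  then show ?thesis
    by (simp add: trace_form_def commutator_def matrix_diff_ldistrib matrix_diff_rdistrib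
        trace_sub matrix_mul_assoc field_simps)
qed

lemma trace_form_commutator_right:
  "trace_form \<eta> (commutator \<xi> \<zeta>) = trace_form (commutator \<zeta> \<eta>) \<xi>"
proof -
  have "commutator \<xi> \<zeta> = - commutator \<zeta> \<xi>"
    by (simp add: commutator_def)
  then have "trace_form \<eta> (commutator \<xi> \<zeta>) = - trace_form \<eta> (commutator \<zeta> \<xi>)"
    by (simp add: trace_form_def commutator_def matrix_diff_ldistrib trace_sub field_simps)
  then show ?thesis
    by (simp add: trace_form_commutator_left)
qed

lemma kks_form_commutator:
  assumes "\<xi> \<in> sp" and "\<zeta> \<in> sp"
  shows "kks_form \<eta> (commutator \<xi> \<eta>) (commutator \<zeta> \<eta>) = trace_form \<eta> (commutator \<xi> \<zeta>)"
  unfolding kks_form_def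
proof (rule the_equality)
  show "\<exists>\<xi>'\<in>sp. \<exists>\<zeta>'\<in>sp. commutator \<xi> \<eta> = commutator \<xi>' \<eta> \<and> commutator \<zeta> \<eta> = commutator \<zeta>' \<eta> \<and>
      trace_form \<eta> (commutator \<xi> \<zeta>) = trace_form \<eta> (commutator \<xi>' \<zeta>')"
    using assms by blast
next
  fix c
  assume "\<exists>\<xi>'\<in>sp. \<exists>\<zeta>'\<in>sp. commutator \<xi> \<eta> = commutator \<xi>' \<eta> \<and> commutator \<zeta> \<eta> = commutator \<zeta>' \<eta> \<and>
      c = trace_form \<eta> (commutator \<xi>' \<zeta>')"
  then obtain \<xi>' \<zeta>' where *: "commutator \<xi> \<eta> = commutator \<xi>' \<eta>" "commutator \<zeta> \<eta> = commutator \<zeta>' \<eta>"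
      "c = trace_form \<eta> (commutator \<xi>' \<zeta>')"
    by blast
  have "c = trace_form \<eta> (commutator \<xi> \<zeta>')"
    using * by (simp add: trace_form_commutator_left)
  also have "\<dots> = trace_form \<eta> (commutator \<xi> \<zeta>)"
    using * by (simp add: trace_form_commutator_right)
  finally show "c = trace_form \<eta> (commutator \<xi> \<zeta>)" .
qed

definition siegel :: "(complex^'n^'n) set" where
  "siegel = {W. transpose W = W \<and> (\<forall>x::real^'n. x \<noteq> 0 \<longrightarrow> 0 < x \<bullet> (map_matrix Im W *v x))}"

definition minus_i_eigenspace :: "real^'m^'m \<Rightarrow> (complex^'m) set" where
  "minus_i_eigenspace \<eta> = {v. map_matrix complex_of_real \<eta> *v v = (- \<i>) *s v}"

definition graph_space :: "complex^'n^'n \<Rightarrow> (complex^('n::finite + 'n)) set" where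
  "graph_space W = {vec_join x (W *v x) | x. True}"

definition upper_half_coord :: "real^('n::finite + 'n)^('n + 'n) \<Rightarrow> complex^'n^'n" where
  "upper_half_coord \<eta> = (THE W. minus_i_eigenspace \<eta> = graph_space W)"

text \<open>The value at the point \<open>W\<close> of the form
  \<open>Tr (B\<^sup>-\<^sup>1 dA \<otimes> B\<^sup>-\<^sup>1 dB - B\<^sup>-\<^sup>1 dB \<otimes> B\<^sup>-\<^sup>1 dA)\<close>, where \<open>A = Re W\<close> and \<open>B = Im W\<close>, on the tangent vectors
  \<open>U\<close> and \<open>V\<close>: the first factor of each tensor product is applied to \<open>U\<close>, the second to \<open>V\<close>, and the
  results are multiplied as matrices.\<close>

definition siegel_form :: "complex^'n^'n \<Rightarrow> complex^'n^'n \<Rightarrow> complex^'n^'n \<Rightarrow> real" where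
  "siegel_form W U V =
    (let Binv = matrix_inv (map_matrix Im W) in
      trace ((Binv ** map_matrix Re U) ** (Binv ** map_matrix Im V)
           - (Binv ** map_matrix Im U) ** (Binv ** map_matrix Re V)))"

end

(* On the orbit, J eta is symmetric positive definite and eta^2 = -1, which forces
     eta = [[B^-1 A, -B^-1], [B + A B^-1 A, -A B^-1]]  with  W = A + i B  in the Siegel half plane.
   Conversely such an eta is S (-J) S^-1 with S = [[P, 0], [A P, B P]] for any P with P^T B P = 1, so
   no square root of B is needed. With a, b the upper blocks of eta, W = -b^-1 (a + i); this smooth
   formula is differentiated along the curves given by the Cayley transform. Finally, tangent vectors
   anticommute with eta, so the symplectic form is -1/4 Tr (X eta Y), which after conjugating A away
   is read off from the upper blocks of X and Y. *)

theory Submission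
  imports Defs
begin

text \<open>The orbit is not open in the space of matrices, so a derivative D of the coordinate
  within the orbit is determined only in tangent directions. Each tangent vector therefore has to be
  realised as the velocity of a curve lying in the orbit. For the same reason W needs a formula on
  an open set of matrices: that formula has a full derivative, and the curve forces D to agree with
  it on tangent vectors. The Cayley transform serves instead of the exponential because it is
  rational: differentiating it needs only the derivative of the matrix inverse, which W = -b^-1 (a +
  i) needs anyway. The constant 1/2 in the result arises as follows. The trace form contributes 1/2,
  and \<open>Tr (X eta Y)\<close> counts \<open>Tr (X zeta)\<close> twice when Y = [zeta, eta]; with
  the sign from cyclicity this gives -1/4. After the shear is conjugated away, the two diagonal
  blocks of the product have equal traces, which gives back a factor 2. The remaining sign matches
  the order of the two terms in \<open>siegel_form\<close>.\<close>

section \<open>Signs, transposes, traces and inverses of matrices\<close>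

lemma matrix_mul_minus_left [simp]: "(- A) ** B = - (A ** (B :: 'a::ring_1^_^_))"
  by (simp add: matrix_matrix_mult_def vec_eq_iff sum_negf)

lemma matrix_mul_minus_right [simp]: "A ** (- B) = - (A ** (B :: 'a::ring_1^_^_))"
  by (simp add: matrix_matrix_mult_def vec_eq_iff sum_negf)

lemma matrix_add_rdistrib: "(A + B) ** C = A ** C + B ** (C :: 'a::semiring_1^_^_)"
  by (simp add: matrix_matrix_mult_def vec_eq_iff distrib_right sum.distrib)

lemma transpose_zero: "transpose 0 = 0"
  by (simp add: transpose_def vec_eq_iff)

lemma transpose_add: "transpose (A + B) = transpose A + transpose B"
  by (simp add: transpose_def vec_eq_iff)

lemma transpose_minus: "transpose (- A) = - transpose A"
  by (simp add: transpose_def vec_eq_iff)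

lemma trace_minus: "trace (- A) = - trace (A :: 'a::comm_ring_1^'n^'n)"
  by (simp add: trace_def sum_negf)

lemma trace_mul_cycle: "trace (A ** B ** C) = trace (C ** A ** (B :: 'a::comm_ring_1^'n^'n))"
  by (metis trace_mul_sym matrix_mul_assoc)

lemma matrix_inv_unique:
  assumes "A ** B = mat 1"
  shows "matrix_inv A = (B :: real^'n^'n)"
proof -
  have BA: "B ** A = mat 1"
    using assms matrix_left_right_inverse by blast
  have "A ** matrix_inv A = mat 1 \<and> matrix_inv A ** A = mat 1"
    unfolding matrix_inv_def by (rule someI[of _ B]) (use assms BA in blast)
  then show ?thesis
    by (metis BA matrix_mul_assoc matrix_mul_lid matrix_mul_rid)
qed

lemma matrix_inv_mat_1: "matrix_inv (mat 1) = (mat 1 :: real^'n^'n)"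
  by (rule matrix_inv_unique) simp

lemma
  assumes "invertible (A :: real^'n^'n)"
  shows matrix_inv_right: "A ** matrix_inv A = mat 1"
    and matrix_inv_left: "matrix_inv A ** A = mat 1"
  using assms matrix_inv_unique unfolding invertible_def by metis+

lemma matrix_inv_mult:
  assumes "invertible (A :: real^'n^'n)" and "invertible (B :: real^'n^'n)"
  shows "matrix_inv (A ** B) = matrix_inv B ** matrix_inv A"
proof (rule matrix_inv_unique)
  show "A ** B ** (matrix_inv B ** matrix_inv A) = mat 1"
    using assms by (metis matrix_inv_right matrix_mul_assoc matrix_mul_rid)
qed

lemma invertible_matrix_inv:
  "invertible (A :: real^'n^'n) \<Longrightarrow> invertible (matrix_inv A)"
  using invertible_def matrix_inv_left matrix_inv_right by blast

lemma transpose_matrix_inv: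
  assumes "invertible (A :: real^'n^'n)"
  shows "transpose (matrix_inv A) = matrix_inv (transpose A)"
  using assms by (metis matrix_inv_left matrix_inv_unique matrix_transpose_mul transpose_mat)

section \<open>Block matrices\<close>

lemma sum_UNIV_Plus:
  "(\<Sum>i\<in>(UNIV :: ('n::finite + 'm::finite) set). f i) = (\<Sum>k\<in>UNIV. f (Inl k)) + (\<Sum>k\<in>UNIV. f (Inr k))"
  using sum.Plus[of "UNIV :: 'n set" "UNIV :: 'm set" f] by (simp add: comp_def)

lemma forall_sum: "(\<forall>i. P i) \<longleftrightarrow> (\<forall>k. P (Inl k)) \<and> (\<forall>k. P (Inr k))"
  by (metis sum.exhaust)

lemma vec_join_nth [simp]:
  "vec_join x y $ Inl k = x $ k" "vec_join x y $ Inr k = y $ k"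
  by (simp_all add: vec_join_def)

lemma vec_join_eq_iff: "vec_join x y = vec_join x' y' \<longleftrightarrow> x = x' \<and> y = y'"
  by (auto simp: vec_eq_iff forall_sum)

lemma vec_join_exhaust: obtains x y where "v = vec_join x y"
proof
  show "v = vec_join (\<chi> k. v $ Inl k) (\<chi> k. v $ Inr k)"
    by (simp add: vec_eq_iff forall_sum)
qed

lemma vec_join_smult: "c *s vec_join x y = vec_join (c *s x) (c *s y)"
  by (simp add: vec_eq_iff forall_sum)

lemma inner_vec_join: "vec_join x y \<bullet> vec_join x' y' = x \<bullet> x' + y \<bullet> y'"
  by (simp add: inner_vec_def sum_UNIV_Plus)

lemma block_matrix_nth [simp]:
  "block_matrix A B C D $ Inl k = vec_join (A $ k) (B $ k)"
  "block_matrix A B C D $ Inr k = vec_join (C $ k) (D $ k)"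
  by (simp_all add: block_matrix_def)

lemma block_matrix_eq_iff:
  "block_matrix A B C D = block_matrix A' B' C' D' \<longleftrightarrow> A = A' \<and> B = B' \<and> C = C' \<and> D = D'"
  by (auto simp: vec_eq_iff forall_sum)

text \<open>Only the upper blocks get names: they determine a point of the orbit, and also a tangent
  vector at a given point.\<close>

definition block_ul where "block_ul M = (\<chi> i j. M $ Inl i $ Inl j)"
definition block_ur where "block_ur M = (\<chi> i j. M $ Inl i $ Inr j)"

lemma block_ul_block [simp]: "block_ul (block_matrix A B C D) = A"
  and block_ur_block [simp]: "block_ur (block_matrix A B C D) = B"
  by (simp_all add: vec_eq_iff block_ul_def block_ur_def)

lemma block_matrix_exhaust: obtains A B C D where "M = block_matrix A B C D"
proof
  show "M = block_matrix (block_ul M) (block_ur M) (\<chi> i j. M $ Inr i $ Inl j) (\<chi> i j. M $ Inr i $ Inr j)"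
    by (simp add: vec_eq_iff forall_sum block_ul_def block_ur_def)
qed

lemma block_matrix_mul:
  "block_matrix A B C D ** block_matrix A' B' C' D' =
    block_matrix (A ** A' + B ** C') (A ** B' + B ** D') (C ** A' + D ** C') (C ** B' + D ** D')"
  by (simp add: vec_eq_iff forall_sum matrix_matrix_mult_def sum_UNIV_Plus)

lemma block_matrix_vector_mul:
  "block_matrix A B C D *v vec_join x y = vec_join (A *v x + B *v y) (C *v x + D *v y)"
  by (simp add: vec_eq_iff forall_sum matrix_vector_mult_def sum_UNIV_Plus)

lemma block_matrix_minus: "- block_matrix A B C D = block_matrix (- A) (- B) (- C) (- D)"
  by (simp add: vec_eq_iff forall_sum)

lemma transpose_block_matrix:
  "transpose (block_matrix A B C D) =
    block_matrix (transpose A) (transpose C) (transpose B) (transpose D)"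
  by (simp add: vec_eq_iff forall_sum transpose_def)

lemma block_matrix_1: "(mat 1 :: 'a::semiring_1^_^_) = block_matrix (mat 1) 0 0 (mat 1)"
  by (simp add: vec_eq_iff forall_sum mat_def)

lemma trace_block_matrix: "trace (block_matrix A B C D) = trace A + trace D"
  by (simp add: trace_def sum_UNIV_Plus)

lemma map_block_matrix:
  "map_matrix f (block_matrix A B C D) =
    block_matrix (map_matrix f A) (map_matrix f B) (map_matrix f C) (map_matrix f D)"
  by (simp add: vec_eq_iff forall_sum)

section \<open>Complex matrices\<close>

definition complex_matrix :: "real^'n^'n \<Rightarrow> real^'n^'n \<Rightarrow> complex^'n^'n" where
  "complex_matrix A B = (\<chi> i j. Complex (A $ i $ j) (B $ i $ j))"

lemma complex_matrix_nth [simp]: "complex_matrix A B $ i $ j = Complex (A $ i $ j) (B $ i $ j)"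
  by (simp add: complex_matrix_def)

lemma Re_complex_matrix [simp]: "map_matrix Re (complex_matrix A B) = A"
  and Im_complex_matrix [simp]: "map_matrix Im (complex_matrix A B) = B"
  by (simp_all add: vec_eq_iff)

lemma complex_matrix_Re_Im: "complex_matrix (map_matrix Re W) (map_matrix Im W) = W"
  by (simp add: vec_eq_iff)

lemma complex_matrix_vector_mul:
  "complex_matrix A B *v x = map_matrix of_real A *v x + \<i> *s (map_matrix of_real B *v x)"
  by (simp add: vec_eq_iff matrix_vector_mult_def complex_eq_iff sum.distrib sum_subtractf
      algebra_simps sum_distrib_left sum_negf)

lemma map_matrix_of_real_mul:
  "map_matrix of_real (A ** B) = map_matrix of_real A ** map_matrix complex_of_real B"
  by (simp add: vec_eq_iff matrix_matrix_mult_def)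

lemma map_matrix_of_real_add:
  "map_matrix of_real (A + B) = map_matrix of_real A + map_matrix complex_of_real B"
  by (simp add: vec_eq_iff)

lemma map_matrix_of_real_minus:
  "map_matrix of_real (- A) = - map_matrix complex_of_real A"
  by (simp add: vec_eq_iff)

lemma map_matrix_of_real_1: "map_matrix complex_of_real (mat 1) = mat 1"
  by (simp add: vec_eq_iff mat_def)

lemma matrix_vector_mul_smult: "A *v (c *s x) = c *s (A *v (x :: 'a::comm_semiring_1^'n))"
  by (simp add: vec_eq_iff matrix_vector_mult_def sum_distrib_left mult.left_commute)

lemma matrix_vector_mul_minus_right: "A *v (- x) = - (A *v (x :: 'a::ring_1^'n))"
  by (simp add: vec_eq_iff matrix_vector_mult_def sum_negf)

lemma matrix_vector_mul_minus_left: "(- A) *v x = - (A *v (x :: 'a::ring_1^'n))"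
  by (simp add: vec_eq_iff matrix_vector_mult_def sum_negf)

text \<open>For invertible B this is the real matrix that acts as -i on the graph of W and, by
  conjugation, as i on the graph of the conjugate of W; the two graphs are complementary because B
  is invertible.\<close>

definition orbit_point :: "complex^'n^'n \<Rightarrow> real^('n::finite + 'n)^('n + 'n)" where
  "orbit_point W = (let A = map_matrix Re W; B = map_matrix Im W; Bi = matrix_inv B in
     block_matrix (Bi ** A) (- Bi) (B + A ** Bi ** A) (- (A ** Bi)))"

section \<open>Positive definite matrices and Gram-Schmidt orthonormalisation\<close>

definition pos_def :: "real^'n^'n \<Rightarrow> bool" where
  "pos_def B \<longleftrightarrow> transpose B = B \<and> (\<forall>x. x \<noteq> 0 \<longrightarrow> 0 < x \<bullet> (B *v x))"

lemma siegel_iff: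
  "W \<in> siegel \<longleftrightarrow> transpose (map_matrix Re W) = map_matrix Re W \<and> pos_def (map_matrix Im W)"
  unfolding siegel_def pos_def_def
  by (auto simp: vec_eq_iff transpose_def complex_eq_iff)

text \<open>A nonzero vector x in the kernel of B would give x . Bx = 0.\<close>

lemma pos_def_invertible: "pos_def B \<Longrightarrow> invertible B"
  unfolding pos_def_def invertible_left_inverse matrix_left_invertible_ker
  by (metis inner_zero_right less_irrefl)

lemma pos_def_congruence:
  assumes "pos_def B" and "invertible (P :: real^'n^'n)"
  shows "pos_def (transpose P ** B ** P)"
  unfolding pos_def_def
proof (intro conjI allI impI)
  show "transpose (transpose P ** B ** P) = transpose P ** B ** P"
    using assms(1) by (simp add: pos_def_def matrix_transpose_mul matrix_mul_assoc)
next
  fix x :: "real^'n"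
  assume "x \<noteq> 0"
  then have "P *v x \<noteq> 0"
    using assms(2) by (metis invertible_left_inverse matrix_left_invertible_ker)
  then have "0 < (P *v x) \<bullet> (B *v (P *v x))"
    using assms(1) by (simp add: pos_def_def)
  then show "0 < x \<bullet> (transpose P ** B ** P *v x)"
    by (metis dot_lmul_matrix matrix_vector_mul_assoc transpose_matrix_vector inner_commute)
qed

text \<open>By symmetry of B, the inverse is itself a congruence of B: it equals B^-T B
  B^-1.\<close>

lemma pos_def_matrix_inv:
  assumes "pos_def B"
  shows "pos_def (matrix_inv B)"
proof -
  have B: "invertible B"
    using assms by (rule pos_def_invertible)
  have "transpose (matrix_inv B) = matrix_inv B"
    using assms B by (simp add: transpose_matrix_inv pos_def_def)
  then have "transpose (matrix_inv B) ** B ** matrix_inv B = matrix_inv B"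
    using B by (simp add: matrix_inv_left)
  then show ?thesis
    using pos_def_congruence[OF assms invertible_matrix_inv[OF B]] by simp
qed

text \<open>Gram-Schmidt for the inner product x . By. The induction runs over sets of matrix
  indices, so that the family for the full index set can serve directly as the columns of a square
  matrix.\<close>

lemma pos_def_orthonormal_family:
  fixes B :: "real^'n^'n"
  assumes B: "pos_def B" and "finite (F :: 'n set)"
  shows "\<exists>f. \<forall>i\<in>F. \<forall>j\<in>F. f i \<bullet> (B *v f j) = (if i = j then 1 else 0)"
  using assms(2)
proof (induction F rule: finite_induct)
  case (insert k F)
  then obtain f where f: "\<And>i j. i \<in> F \<Longrightarrow> j \<in> F \<Longrightarrow> f i \<bullet> (B *v f j) = (if i = j then 1 else 0)"
    by blast
  have sym: "x \<bullet> (B *v y) = y \<bullet> (B *v x)" for x y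
    using B unfolding pos_def_def
    by (metis dot_lmul_matrix transpose_matrix_vector inner_commute)
  \<comment> \<open>Fewer than n vectors cannot span the whole space, so a vector outside their span
    is available for the next Gram-Schmidt step.\<close>
  have "dim (f ` F) \<le> card F"
    using insert.hyps(1) by (meson card_image_le dim_le_card' finite_imageI order_trans)
  also have "\<dots> < CARD('n)"
    using insert.hyps by (metis UNIV_I finite psubsetI psubset_card_mono subset_UNIV)
  finally have "span (f ` F) \<noteq> UNIV"
    by (metis dim_span dim_UNIV DIM_cart DIM_real mult.right_neutral less_irrefl)
  then obtain x where x: "x \<notin> span (f ` F)"
    by blast
  define y where "y = x - (\<Sum>i\<in>F. (f i \<bullet> (B *v x)) *\<^sub>R f i)"
  have "(\<Sum>i\<in>F. (f i \<bullet> (B *v x)) *\<^sub>R f i) \<in> span (f ` F)"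
    by (intro span_sum span_scale span_base) simp
  then have "y \<noteq> 0"
    using x by (auto simp: y_def)
  then have pos: "0 < y \<bullet> (B *v y)"
    using B by (simp add: pos_def_def)
  have orth: "f j \<bullet> (B *v y) = 0" if "j \<in> F" for j
  proof -
    have "f j \<bullet> (B *v y) = y \<bullet> (B *v f j)"
      by (rule sym)
    also have "\<dots> = x \<bullet> (B *v f j) - (\<Sum>i\<in>F. (f i \<bullet> (B *v x)) * (f i \<bullet> (B *v f j)))"
      by (simp add: y_def inner_diff_left inner_sum_left)
    also have "(\<Sum>i\<in>F. (f i \<bullet> (B *v x)) * (f i \<bullet> (B *v f j))) =
        (\<Sum>i\<in>F. if i = j then f j \<bullet> (B *v x) else 0)"
      using that f by (intro sum.cong) auto
    also have "\<dots> = f j \<bullet> (B *v x)"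
      using that insert.hyps(1) by simp
    finally show ?thesis
      using sym[of x "f j"] by simp
  qed
  define z where "z = (1 / sqrt (y \<bullet> (B *v y))) *\<^sub>R y"
  have zz: "z \<bullet> (B *v z) = 1"
    using pos by (simp add: z_def matrix_vector_mult_scaleR)
  have fz: "f j \<bullet> (B *v z) = 0" "z \<bullet> (B *v f j) = 0" if "j \<in> F" for j
    using orth[OF that] sym[of z "f j"] by (simp_all add: z_def matrix_vector_mult_scaleR)
  have "\<forall>i\<in>insert k F. \<forall>j\<in>insert k F.
      (f(k := z)) i \<bullet> (B *v (f(k := z)) j) = (if i = j then 1 else 0)"
    using f fz zz insert.hyps(2) by auto
  then show ?case
    by blast
qed simp

text \<open>The Gram matrix of the columns of P for the inner product x . By is P^T B P.\<close>

lemma pos_def_diagonalize: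
  assumes "pos_def (B :: real^'n^'n)"
  obtains P :: "real^'n^'n" where "transpose P ** B ** P = mat 1"
proof -
  obtain f :: "'n \<Rightarrow> real^'n" where f: "\<And>i j. f i \<bullet> (B *v f j) = (if i = j then 1 else 0)"
    using pos_def_orthonormal_family[OF assms, of UNIV] by auto
  define P where "P = transpose (\<chi> i. f i)"
  have "(transpose P ** (B ** P)) $ i $ j = f i \<bullet> (B *v f j)" for i j
    by (simp add: P_def matrix_matrix_mult_def matrix_vector_mult_def inner_vec_def transpose_def)
  then have "transpose P ** B ** P = mat 1"
    using f by (simp add: vec_eq_iff mat_def matrix_mul_assoc)
  then show thesis ..
qed

section \<open>The orbit\<close>

lemma symp_J_mul_symp_J: "symp_J ** symp_J = - mat 1"
  by (simp add: symp_J_def block_matrix_mul block_matrix_1 block_matrix_minus block_matrix_eq_iff)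

text \<open>Since J^2 = -1, multiplying S^T J S = J by -J exhibits -J S^T J as a left inverse of
  S.\<close>

lemma Sp_invertible:
  assumes "S \<in> Sp"
  shows "invertible S"
proof -
  have "(- symp_J) ** transpose S ** symp_J ** S = - (symp_J ** symp_J)"
    using assms by (simp add: Sp_def flip: matrix_mul_assoc)
  then have "(- symp_J) ** transpose S ** symp_J ** S = mat 1"
    by (simp add: symp_J_mul_symp_J)
  then show ?thesis
    using invertible_left_inverse by blast
qed

lemma Sp_mul: "S \<in> Sp \<Longrightarrow> T \<in> Sp \<Longrightarrow> S ** T \<in> Sp"
  by (simp add: Sp_def matrix_transpose_mul) (metis matrix_mul_assoc)

lemma Sp_conj_orbit:
  assumes "S \<in> Sp" and "\<eta> \<in> orbit"
  shows "S ** \<eta> ** matrix_inv S \<in> orbit"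
proof -
  obtain T where T: "T \<in> Sp" "\<eta> = T ** (- symp_J) ** matrix_inv T"
    using assms(2) by (auto simp: orbit_def)
  then have "S ** \<eta> ** matrix_inv S = (S ** T) ** (- symp_J) ** matrix_inv (S ** T)"
    using assms(1) by (simp add: matrix_inv_mult Sp_invertible matrix_mul_assoc)
  then show ?thesis
    using Sp_mul[OF assms(1) T(1)] by (auto simp: orbit_def)
qed

text \<open>The matrix S is diag(P, P^-T) followed by the lower shear by A, since B P = P^-T. On the
  half plane the diagonal factor takes i to P^-T (i) P^-1 = i B, and the shear adds A.\<close>

lemma orbit_point_in_orbit:
  fixes W :: "complex^'n^'n"
  assumes "W \<in> siegel"
  shows "orbit_point W \<in> orbit"
proof -
  define A B Bi where "A = map_matrix Re W" and "B = map_matrix Im W" and "Bi = matrix_inv B"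
  have A: "transpose A = A" and B: "pos_def B"
    using assms by (simp_all add: siegel_iff A_def B_def)
  obtain P :: "real^'n^'n" where P: "transpose P ** B ** P = mat 1"
    using pos_def_diagonalize[OF B] .
  define Q where "Q = B ** P"
  have tB: "transpose B = B"
    using B by (simp add: pos_def_def)
  have BBi: "B ** Bi = mat 1" "Bi ** B = mat 1"
    by (simp_all add: Bi_def matrix_inv_right matrix_inv_left B pos_def_invertible)
  have PQ: "transpose P ** Q = mat 1" "transpose Q ** P = mat 1"
    using P by (simp_all add: Q_def matrix_mul_assoc matrix_transpose_mul tB)
  have BiQ: "Bi ** Q = P"
    by (simp add: Q_def matrix_mul_assoc BBi)
  define S where "S = block_matrix P 0 (A ** P) Q"
  have S: "S \<in> Sp"
    using PQ by (simp add: S_def Sp_def symp_J_def transpose_block_matrix block_matrix_mul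
        block_matrix_eq_iff matrix_transpose_mul A matrix_mul_assoc transpose_zero)
  \<comment> \<open>The conjugation is checked in the form S (-J) = \<eta> S, so that the blocks of
    the inverse of S never have to be computed.\<close>
  have "S ** (- symp_J) = orbit_point W ** S"
    by (simp add: S_def symp_J_def orbit_point_def Let_def block_matrix_mul block_matrix_minus
        block_matrix_eq_iff matrix_add_rdistrib flip: A_def B_def Bi_def matrix_mul_assoc)
      (use BiQ in \<open>simp add: Q_def\<close>)
  then have "S ** (- symp_J) ** matrix_inv S = orbit_point W"
    by (metis S Sp_invertible matrix_inv_right matrix_mul_assoc matrix_mul_rid)
  then show ?thesis
    using S unfolding orbit_def by (intro CollectI exI[of _ S]) simp
qed

lemma orbit_is_orbit_point:
  fixes \<eta> :: "real^('n::finite + 'n)^('n + 'n)"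
  assumes "\<eta> \<in> orbit"
  obtains W where "W \<in> siegel" and "\<eta> = orbit_point W"
proof -
  obtain S where S: "S \<in> Sp" and \<eta>: "\<eta> = S ** (- symp_J) ** matrix_inv S"
    using assms by (auto simp: orbit_def)
  define T where "T = matrix_inv S"
  have invS: "invertible S"
    using S by (rule Sp_invertible)
  have ST: "S ** T = mat 1" "T ** S = mat 1"
    using invS by (simp_all add: T_def matrix_inv_right matrix_inv_left)
  have "transpose T ** transpose S ** symp_J ** S = transpose T ** symp_J"
    using S by (simp add: Sp_def flip: matrix_mul_assoc)
  moreover have "transpose T ** transpose S = mat 1"
    by (simp add: ST flip: matrix_transpose_mul)
  ultimately have JS: "symp_J ** S = transpose T ** symp_J"
    by simp
  \<comment> \<open>Moving J past S turns J \<eta> into T^T T with T = S^-1, a matrix congruent to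
    the identity; this is where positive definiteness comes from.\<close>
  have "symp_J ** \<eta> = transpose T ** (symp_J ** - symp_J) ** T"
    by (simp add: \<eta> matrix_mul_assoc JS flip: T_def)
  then have J\<eta>: "symp_J ** \<eta> = transpose T ** mat 1 ** T"
    by (simp add: symp_J_mul_symp_J)
  have "pos_def (mat 1 :: real^('n + 'n)^('n + 'n))"
    by (simp add: pos_def_def)
  then have pd: "pos_def (symp_J ** \<eta>)"
    using J\<eta> pos_def_congruence invertible_matrix_inv[OF invS] unfolding T_def by metis
  have "\<eta> ** \<eta> = S ** - symp_J ** (T ** S) ** - symp_J ** T"
    by (simp add: \<eta> matrix_mul_assoc flip: T_def)
  also have "\<dots> = S ** (symp_J ** symp_J) ** T"
    by (simp add: ST matrix_mul_assoc)
  finally have sq: "\<eta> ** \<eta> = - mat 1"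
    by (simp add: symp_J_mul_symp_J ST)
  obtain a b c d where abcd: "\<eta> = block_matrix a b c d"
    by (rule block_matrix_exhaust)
  have J: "symp_J ** \<eta> = block_matrix c d (- a) (- b)"
    by (simp add: abcd symp_J_def block_matrix_mul)
  have ad: "transpose a = - d"
    using pd by (simp add: pos_def_def J transpose_block_matrix block_matrix_eq_iff
        transpose_minus) (metis minus_minus)
  \<comment> \<open>The lower right block of \<open>symp_J ** \<eta>\<close> is \<open>- b\<close>,
    so its positivity is that of J \<eta> on the vectors (0, x).\<close>
  have pb: "pos_def (- b)"
    unfolding pos_def_def
  proof (intro conjI allI impI)
    show "transpose (- b) = - b"
      using pd by (simp add: pos_def_def J transpose_block_matrix block_matrix_eq_iff)
  next
    fix x :: "real^'n"
    assume "x \<noteq> 0"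
    then have "vec_join 0 x \<noteq> 0"
      by (simp add: vec_eq_iff forall_sum)
    then have "0 < vec_join 0 x \<bullet> (symp_J ** \<eta> *v vec_join 0 x)"
      using pd by (simp add: pos_def_def)
    then show "0 < x \<bullet> (- b *v x)"
      by (simp add: J block_matrix_vector_mul inner_vec_join)
  qed
  \<comment> \<open>Both choices are forced by the upper blocks of \<open>orbit_point\<close>, which
    must satisfy -B^-1 = b and B^-1 A = a.\<close>
  define B where "B = matrix_inv (- b)"
  define A where "A = B ** a"
  have pB: "pos_def B"
    unfolding B_def using pb by (rule pos_def_matrix_inv)
  have Bb: "B ** b = - mat 1" "b ** B = - mat 1"
    using matrix_inv_left[OF pos_def_invertible[OF pb]] matrix_inv_right[OF pos_def_invertible[OF pb]]
    by (simp_all add: B_def minus_equation_iff[of "mat 1"] eq_commute)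
  have Bi: "matrix_inv B = - b"
    by (rule matrix_inv_unique) (simp add: Bb)
  have sq1: "a ** a + b ** c = - mat 1" and sq2: "a ** b + b ** d = 0"
    using sq by (simp_all add: abcd block_matrix_mul block_matrix_1 block_matrix_minus
        block_matrix_eq_iff)
  have dA: "d = A ** b"
  proof -
    have "B ** (a ** b + b ** d) = 0"
      by (simp add: sq2)
    then show ?thesis
      by (simp add: matrix_add_ldistrib matrix_mul_assoc Bb A_def)
  qed
  have cA: "c = B - A ** b ** A"
  proof -
    have "B ** (a ** a + b ** c) = - B"
      by (simp add: sq1)
    then have "c = B + B ** a ** a"
      by (simp add: matrix_add_ldistrib matrix_mul_assoc Bb algebra_simps)
    moreover have "A ** b ** A = - (B ** a ** a)"
    proof -
      have "A ** b ** A = B ** a ** (b ** B) ** a"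
        by (simp add: A_def matrix_mul_assoc)
      then show ?thesis
        by (simp add: Bb)
    qed
    ultimately show ?thesis
      by simp
  qed
  have aA: "a = - b ** A"
    by (simp add: A_def matrix_mul_assoc Bb)
  have tb: "transpose b = b"
    using pb by (simp add: pos_def_def transpose_minus)
  have tB: "transpose B = B"
    using pB by (simp add: pos_def_def)
  \<comment> \<open>Symmetry of A combines both facts about \<eta>: a^T = -d comes from the symmetry
    of J \<eta>, and d = A b from \<eta>^2 = -1.\<close>
  have "transpose A = transpose a ** B"
    by (simp add: A_def matrix_transpose_mul tB)
  also have "\<dots> = - (A ** (b ** B))"
    by (simp add: ad dA matrix_mul_assoc)
  finally have tA: "transpose A = A"
    by (simp add: Bb)
  show thesis
  proof
    show "complex_matrix A B \<in> siegel"
      using tA pB by (simp add: siegel_iff)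
    show "\<eta> = orbit_point (complex_matrix A B)"
      using aA dA cA by (simp add: orbit_point_def abcd Bi block_matrix_eq_iff)
  qed
qed

section \<open>The coordinate\<close>

text \<open>The upper block row of the eigenvector equation already forces y = W x, after
  multiplication by B; the lower row is then a consequence and is only verified in the converse
  direction.\<close>

lemma minus_i_eigenspace_orbit_point:
  assumes "W \<in> siegel"
  shows "minus_i_eigenspace (orbit_point W) = graph_space W"
proof -
  define A B Bi where "A = map_matrix Re W" and "B = map_matrix Im W" and "Bi = matrix_inv B"
  have B: "pos_def B"
    using assms by (simp add: siegel_iff B_def)
  have BBi: "B ** Bi = mat 1" "Bi ** B = mat 1"
    by (simp_all add: Bi_def matrix_inv_right matrix_inv_left B pos_def_invertible)
  let ?c = "map_matrix complex_of_real"
  have cBBi: "?c B ** ?c Bi = mat 1" "?c Bi ** ?c B = mat 1"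
    by (simp_all add: BBi map_matrix_of_real_1 flip: map_matrix_of_real_mul)
  have W: "W *v x = ?c A *v x + \<i> *s (?c B *v x)" for x
    by (metis A_def B_def complex_matrix_Re_Im complex_matrix_vector_mul)
  have eq: "?c (orbit_point W) *v vec_join x y = (- \<i>) *s vec_join x y \<longleftrightarrow> y = W *v x" for x y
  proof
    assume "?c (orbit_point W) *v vec_join x y = (- \<i>) *s vec_join x y"
    then have "?c Bi *v (?c A *v x) - ?c Bi *v y = (- \<i>) *s x"
      by (simp add: orbit_point_def Let_def map_block_matrix block_matrix_vector_mul vec_join_smult
          vec_join_eq_iff map_matrix_of_real_mul map_matrix_of_real_minus matrix_vector_mul_minus_left
          matrix_vector_mul_assoc flip: A_def B_def Bi_def)
    then have "?c B *v (?c Bi *v (?c A *v x) - ?c Bi *v y) = (- \<i>) *s (?c B *v x)"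
      by (simp add: matrix_vector_mul_smult matrix_vector_mul_minus_right)
    then have "?c A *v x - y = (- \<i>) *s (?c B *v x)"
      by (simp add: matrix_vector_mult_diff_distrib matrix_vector_mul_assoc matrix_mul_assoc cBBi)
    then show "y = W *v x"
      by (simp add: W algebra_simps)
  next
    assume y: "y = W *v x"
    have 1: "?c Bi *v y = ?c Bi *v (?c A *v x) + \<i> *s x"
      by (simp add: y W matrix_vector_right_distrib matrix_vector_mul_smult matrix_vector_mul_assoc cBBi)
    show "?c (orbit_point W) *v vec_join x y = (- \<i>) *s vec_join x y"
      using 1
      by (simp add: orbit_point_def Let_def map_block_matrix block_matrix_vector_mul vec_join_smult
          vec_join_eq_iff map_matrix_of_real_mul map_matrix_of_real_minus matrix_vector_mul_minus_left
          map_matrix_of_real_add matrix_vector_mult_add_rdistrib matrix_vector_right_distrib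
          matrix_vector_mul_smult flip: A_def B_def Bi_def matrix_vector_mul_assoc)
       (simp add: y W vec_eq_iff algebra_simps)
  qed
  show ?thesis
    unfolding minus_i_eigenspace_def graph_space_def
    using eq by (auto elim!: vec_join_exhaust) (metis vec_join_exhaust)
qed

text \<open>This is the uniqueness behind the description that defines
  \<open>upper_half_coord\<close>.\<close>

lemma graph_space_inject: "graph_space W = graph_space W' \<longleftrightarrow> W = W'"
proof
  assume "graph_space W = graph_space W'"
  then have "vec_join x (W *v x) \<in> graph_space W'" for x
    by (auto simp: graph_space_def)
  then have "W *v x = W' *v x" for x
    by (auto simp: graph_space_def vec_join_eq_iff)
  then show "W = W'"
    by (simp add: matrix_eq)
qed simp

lemma upper_half_coord_orbit_point:
  assumes "W \<in> siegel"
  shows "upper_half_coord (orbit_point W) = W"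
  unfolding upper_half_coord_def minus_i_eigenspace_orbit_point[OF assms]
  by (rule the_equality) (simp_all add: graph_space_inject)

lemma bij_betw_upper_half_coord: "bij_betw upper_half_coord orbit siegel"
proof (rule bij_betwI[where g = orbit_point])
  show "upper_half_coord \<in> orbit \<rightarrow> siegel"
    by (metis Pi_I orbit_is_orbit_point upper_half_coord_orbit_point)
  show "orbit_point \<in> siegel \<rightarrow> orbit"
    by (simp add: orbit_point_in_orbit)
  show "orbit_point (upper_half_coord \<eta>) = \<eta>" if "\<eta> \<in> orbit" for \<eta>
    using that by (metis orbit_is_orbit_point upper_half_coord_orbit_point)
qed (simp add: upper_half_coord_orbit_point)

section \<open>Differentiating the matrix inverse\<close>

lemma differentiable_vec_iff:
  fixes f :: "'a::real_normed_vector \<Rightarrow> 'b::euclidean_space^'n"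
  shows "f differentiable (at x within S) \<longleftrightarrow> (\<forall>i. (\<lambda>x. f x $ i) differentiable (at x within S))"
proof
  assume "f differentiable (at x within S)"
  then show "\<forall>i. (\<lambda>x. f x $ i) differentiable (at x within S)"
    unfolding differentiable_def
    using bounded_linear.has_derivative[OF bounded_linear_vec_nth] by blast
next
  assume "\<forall>i. (\<lambda>x. f x $ i) differentiable (at x within S)"
  then have "\<forall>i. \<exists>D. ((\<lambda>x. f x $ i) has_derivative D) (at x within S)"
    by (simp add: differentiable_def)
  from choice[OF this] obtain D where D: "\<And>i. ((\<lambda>x. f x $ i) has_derivative D i) (at x within S)"
    by blast
  have "((\<lambda>x. f x \<bullet> b) has_derivative (\<lambda>h. (\<chi> i. D i h) \<bullet> b)) (at x within S)" for b
    unfolding inner_vec_def vec_lambda_beta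
    by (rule has_derivative_sum) (rule has_derivative_inner_left[OF D])
  then have "(f has_derivative (\<lambda>h. \<chi> i. D i h)) (at x within S)"
    by (subst has_derivative_componentwise_within) blast
  then show "f differentiable (at x within S)"
    unfolding differentiable_def by blast
qed

lemma differentiable_prod:
  fixes f :: "'i \<Rightarrow> 'a::real_normed_vector \<Rightarrow> real"
  assumes "finite I" and "\<And>i. i \<in> I \<Longrightarrow> f i differentiable (at x within S)"
  shows "(\<lambda>x. \<Prod>i\<in>I. f i x) differentiable (at x within S)"
  using assms by (induction I rule: finite_induct) auto

lemma differentiable_det:
  fixes f :: "'a::real_normed_vector \<Rightarrow> real^'n^'n"
  assumes "\<And>i j. (\<lambda>x. f x $ i $ j) differentiable (at x within S)"
  shows "(\<lambda>x. det (f x)) differentiable (at x within S)"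
  unfolding det_def
proof (rule differentiable_sum)
  show "\<forall>p\<in>{p. p permutes UNIV}.
      (\<lambda>x. of_int (sign p) * (\<Prod>i\<in>UNIV. f x $ i $ p i)) differentiable (at x within S)"
    by (intro ballI differentiable_mult[OF differentiable_const] differentiable_prod assms) simp
qed (simp add: finite_permutations)

text \<open>By Cramer's rule the entries of the inverse are quotients of determinants, hence
  differentiable. The derivative itself is not computed from them: once it is known to exist, the
  equation X X^-1 = 1 determines it.\<close>

lemma differentiable_matrix_inv:
  fixes A :: "real^'n^'n"
  assumes "invertible A"
  shows "matrix_inv differentiable (at A)"
proof -
  have entry: "(\<lambda>X. X $ i $ j) differentiable (at A)" for i j
    by (rule differentiableI, rule bounded_linear_imp_has_derivative)
      (rule bounded_linear_compose[OF bounded_linear_vec_nth bounded_linear_vec_nth])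
  then have det: "det differentiable (at A)"
    by (rule differentiable_det)
  have det0: "det A \<noteq> 0"
    using assms by (simp add: invertible_det_nz)
  \<comment> \<open>Cramer's formula with the l-th unit vector as right-hand side gives the l-th
    column of the inverse. Where the determinant vanishes, division by zero makes \<open>g\<close>
    equal to 0; agreement with \<open>matrix_inv\<close> near A is enough.\<close>
  define g :: "real^'n^'n \<Rightarrow> real^'n^'n" where
    "g X = (\<chi> k l. det (\<chi> i j. if j = k then axis l 1 $ i else X $ i $ j) / det X)" for X
  have gX: "g X = matrix_inv X" if "det X \<noteq> 0" for X
  proof -
    have "X *v column l (matrix_inv X) = axis l 1" for l
      using that by (simp add: invertible_det_nz matrix_inv_right matrix_vector_mul_assoc
          flip: matrix_vector_mult_basis)
    then have "column l (matrix_inv X) =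
        (\<chi> k. det (\<chi> i j. if j = k then axis l 1 $ i else X $ i $ j) / det X)" for l
      using cramer[OF that] by blast
    then show ?thesis
      by (simp add: g_def vec_eq_iff column_def)
  qed
  have "g differentiable (at A)"
    unfolding g_def
  proof (intro differentiable_vec_iff[THEN iffD2] allI, simp only: vec_lambda_beta)
    fix k l
    show "(\<lambda>X. det (\<chi> i j. if j = k then axis l 1 $ i else X $ i $ j) / det X) differentiable (at A)"
    proof (rule differentiable_divide[OF differentiable_det det det0])
      show "(\<lambda>X. (\<chi> i j. if j = k then axis l 1 $ i else X $ i $ j) $ i $ j) differentiable (at A)" for i j
        using entry by (cases "j = k") simp_all
    qed
  qed
  then obtain D where D: "(g has_derivative D) (at A)"
    by (auto simp: differentiable_def)
  have "continuous (at A) det"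
    using det by (rule differentiable_imp_continuous_within)
  then have "\<forall>\<^sub>F X in at A. det X \<noteq> 0"
    using det0 by (metis continuous_within tendsto_imp_eventually_ne)
  then have "\<forall>\<^sub>F X in at A. g X = matrix_inv X"
    by (rule eventually_mono) (rule gX)
  with D have "(matrix_inv has_derivative D) (at A)"
    using gX[OF det0] by (rule has_derivative_transform_eventually) simp
  then show ?thesis
    by (auto simp: differentiable_def)
qed

lemma bounded_bilinear_matrix_mul:
  "bounded_bilinear ((**) :: real^'n^'m \<Rightarrow> real^'k^'n \<Rightarrow> real^'k^'m)"
  unfolding bilinear_conv_bounded_bilinear[symmetric] bilinear_def
  by (intro conjI allI linearI)
    (simp_all add: matrix_add_ldistrib matrix_add_rdistrib matrix_scalar_ac scalar_matrix_assoc)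

lemmas has_derivative_matrix_mul = bounded_bilinear.FDERIV[OF bounded_bilinear_matrix_mul]

text \<open>The determinant is continuous along f and nonzero at x. Using \<open>nhds\<close> rather
  than \<open>at\<close> keeps the point x itself included.\<close>

lemma eventually_invertible:
  fixes f :: "'a::real_normed_vector \<Rightarrow> real^'n^'n"
  assumes "(f has_derivative f') (at x)" and "invertible (f x)"
  shows "\<forall>\<^sub>F y in nhds x. invertible (f y)"
proof -
  have "(\<lambda>y. f y $ i $ j) differentiable (at x)" for i j
    using assms(1) by (auto simp: differentiable_def dest!: bounded_linear.has_derivative[OF bounded_linear_vec_nth])
  then have "continuous (at x) (\<lambda>y. det (f y))"
    by (intro differentiable_imp_continuous_within differentiable_det)
  then have "((\<lambda>y. det (f y)) \<longlongrightarrow> det (f x)) (nhds x)"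
    by (simp add: continuous_at tendsto_nhds_iff)
  then show ?thesis
    using assms(2) by (auto simp: invertible_det_nz dest: tendsto_imp_eventually_ne)
qed

text \<open>Differentiating X X^-1 = 1, which holds near A, gives A (D H) + H A^-1 = 0 for the
  derivative D already known to exist; solving for D H yields the formula.\<close>

lemma has_derivative_matrix_inv_at:
  fixes A :: "real^'n^'n"
  assumes "invertible A"
  shows "(matrix_inv has_derivative (\<lambda>H. - (matrix_inv A ** H ** matrix_inv A))) (at A)"
proof -
  obtain D where D: "(matrix_inv has_derivative D) (at A)"
    using differentiable_matrix_inv[OF assms] by (auto simp: differentiable_def)
  have 1: "((\<lambda>X. X ** matrix_inv X) has_derivative (\<lambda>H. A ** D H + H ** matrix_inv A)) (at A)"
    by (rule has_derivative_matrix_mul[OF has_derivative_ident D])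
  have "\<forall>\<^sub>F X in nhds A. invertible X"
    using eventually_invertible[OF has_derivative_ident] assms by blast
  then have ev: "\<forall>\<^sub>F X in nhds A. X ** matrix_inv X = mat 1"
    by (rule eventually_mono) (rule matrix_inv_right)
  have "((\<lambda>X. mat 1) has_derivative (\<lambda>H. A ** D H + H ** matrix_inv A)) (at A)"
    using 1 by (rule has_derivative_transform_eventually)
      (use ev eventually_nhds_x_imp_x[OF ev] in \<open>auto simp: eventually_at_filter elim: eventually_mono\<close>)
  then have "(\<lambda>H. A ** D H + H ** matrix_inv A) = (\<lambda>H. 0)"
    using has_derivative_const has_derivative_unique by blast
  then have *: "A ** D H + H ** matrix_inv A = 0" for H
    by metis
  have "matrix_inv A ** (A ** D H + H ** matrix_inv A) = D H + matrix_inv A ** H ** matrix_inv A" for H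
    by (simp add: matrix_add_ldistrib matrix_mul_assoc matrix_inv_left assms)
  then have "D H = - (matrix_inv A ** H ** matrix_inv A)" for H
    by (simp add: * eq_neg_iff_add_eq_0)
  then show ?thesis
    using D by presburger
qed

lemma has_derivative_matrix_inv:
  fixes f :: "'a::real_normed_vector \<Rightarrow> real^'n^'n"
  assumes "(f has_derivative f') (at x)" and "invertible (f x)"
  shows "((\<lambda>y. matrix_inv (f y)) has_derivative
    (\<lambda>h. - (matrix_inv (f x) ** f' h ** matrix_inv (f x)))) (at x)"
  using has_derivative_compose[OF assms(1) has_derivative_matrix_inv_at[OF assms(2)]] .

section \<open>Curves in the orbit\<close>

text \<open>The Cayley transform turns \<open>\<xi> \<in> sp\<close> into a curve in \<open>Sp\<close> with velocity \<open>\<xi>\<close> at \<open>0\<close>.\<close>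

definition cayley :: "real^'m^'m \<Rightarrow> real \<Rightarrow> real^'m^'m" where
  "cayley \<xi> t = matrix_inv (mat 1 - (t / 2) *\<^sub>R \<xi>) ** (mat 1 + (t / 2) *\<^sub>R \<xi>)"

lemma cayley_0: "cayley \<xi> 0 = mat 1"
  by (simp add: cayley_def matrix_inv_unique)

text \<open>For \<xi> in the Lie algebra, J exchanges the two factors: with N = 1 - (t/2) \<xi> and
  M = 1 + (t/2) \<xi> one has N^T J = J M and M^T J = J N. As M and N commute, the factors cancel in
  the symplectic condition for N^-1 M.\<close>

lemma cayley_in_Sp:
  assumes \<xi>: "\<xi> \<in> sp" and inv: "invertible (mat 1 - (t / 2) *\<^sub>R \<xi>)"
  shows "cayley \<xi> t \<in> Sp"
proof -
  define M where "M = mat 1 + (t / 2) *\<^sub>R \<xi>"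
  define N where "N = mat 1 - (t / 2) *\<^sub>R \<xi>"
  define Ni where "Ni = matrix_inv N"
  have NNi: "N ** Ni = mat 1" "Ni ** N = mat 1"
    using inv by (simp_all add: N_def Ni_def matrix_inv_right matrix_inv_left)
  have \<xi>J: "transpose \<xi> ** symp_J = - (symp_J ** \<xi>)"
    using \<xi> by (simp add: sp_def eq_neg_iff_add_eq_0)
  have JM: "transpose N ** symp_J = symp_J ** M" and MJ: "transpose M ** symp_J = symp_J ** N"
    by (simp_all add: M_def N_def transpose_add transpose_minus transpose_scalar diff_conv_add_uminus
        matrix_add_ldistrib matrix_add_rdistrib matrix_scalar_ac \<xi>J del: add_uminus_conv_diff
        flip: scalar_matrix_assoc)
  have MN: "M ** N = N ** M"
    by (simp add: M_def N_def matrix_diff_ldistrib matrix_diff_rdistrib matrix_add_ldistrib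
        matrix_add_rdistrib)
  have NiM: "Ni ** M = M ** Ni"
  proof -
    have "Ni ** (M ** N) ** Ni = Ni ** (N ** M) ** Ni"
      by (simp add: MN)
    then have "Ni ** M ** (N ** Ni) = (Ni ** N) ** M ** Ni"
      by (simp only: matrix_mul_assoc)
    then show ?thesis
      by (simp add: NNi)
  qed
  have "transpose Ni ** transpose N = mat 1"
    by (simp add: NNi flip: matrix_transpose_mul)
  then have J: "transpose Ni ** symp_J ** M = symp_J"
    by (metis JM matrix_mul_assoc matrix_mul_lid)
  have "transpose (M ** Ni) ** symp_J ** (Ni ** M) = transpose Ni ** (transpose M ** symp_J) ** Ni ** M"
    by (simp add: matrix_transpose_mul matrix_mul_assoc)
  also have "\<dots> = transpose Ni ** symp_J ** (N ** Ni) ** M"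
    by (simp only: MJ matrix_mul_assoc)
  also have "\<dots> = symp_J"
    by (simp add: NNi J)
  finally show ?thesis
    unfolding Sp_def cayley_def by (simp add: NiM flip: M_def N_def Ni_def)
qed

lemma
  fixes \<xi> :: "real^'m^'m"
  shows has_derivative_cayley: "(cayley \<xi> has_derivative (\<lambda>t. t *\<^sub>R \<xi>)) (at 0)"
    and eventually_cayley_regular: "\<forall>\<^sub>F t in nhds 0. invertible (mat 1 - (t / 2) *\<^sub>R \<xi>)"
proof -
  have I: "invertible (mat 1 :: real^'m^'m)"
    by (auto simp: invertible_def)
  have N: "((\<lambda>t. mat 1 - (t / 2) *\<^sub>R \<xi>) has_derivative (\<lambda>t. - ((t / 2) *\<^sub>R \<xi>))) (at 0)"
    and M: "((\<lambda>t. mat 1 + (t / 2) *\<^sub>R \<xi>) has_derivative (\<lambda>t. (t / 2) *\<^sub>R \<xi>)) (at 0)"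
    by (auto intro!: derivative_eq_intros)
  show "\<forall>\<^sub>F t in nhds 0. invertible (mat 1 - (t / 2) *\<^sub>R \<xi>)"
    using eventually_invertible[OF N] I by simp
  \<comment> \<open>Numerator and inverted denominator each contribute half of the velocity; this is
    the reason for t / 2 in \<open>cayley\<close>.\<close>
  have "((\<lambda>t. matrix_inv (mat 1 - (t / 2) *\<^sub>R \<xi>) ** (mat 1 + (t / 2) *\<^sub>R \<xi>)) has_derivative
      (\<lambda>t. (t / 2) *\<^sub>R \<xi> + (t / 2) *\<^sub>R \<xi>)) (at 0)"
    using has_derivative_matrix_mul[OF has_derivative_matrix_inv[OF N] M] I
    by (simp add: matrix_inv_mat_1)
  then show "(cayley \<xi> has_derivative (\<lambda>t. t *\<^sub>R \<xi>)) (at 0)"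
    by (simp add: cayley_def[abs_def] flip: scaleR_add_left)
qed

text \<open>Conjugating \<eta> by the Cayley curve of \<xi> gives velocity [\<xi>, \<eta>] at 0. The
  curve is only claimed to stay in the orbit near 0, where the denominator of the Cayley transform
  is invertible.\<close>

lemma orbit_curve:
  assumes \<eta>: "\<eta> \<in> orbit" and X: "X \<in> orbit_tangent \<eta>"
  obtains \<gamma> :: "real \<Rightarrow> real^('n::finite + 'n)^('n + 'n)"
  where "\<gamma> 0 = \<eta>" and "(\<gamma> has_derivative (\<lambda>t. t *\<^sub>R X)) (at 0)" and "\<forall>\<^sub>F t in nhds 0. \<gamma> t \<in> orbit"
proof -
  obtain \<xi> where \<xi>: "\<xi> \<in> sp" "X = commutator \<xi> \<eta>"
    using X by (auto simp: orbit_tangent_def)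
  define \<gamma> where "\<gamma> t = cayley \<xi> t ** \<eta> ** matrix_inv (cayley \<xi> t)" for t
  have I: "invertible (cayley \<xi> 0)"
    by (auto simp: invertible_def cayley_0)
  show thesis
  proof
    show "\<gamma> 0 = \<eta>"
      by (simp add: \<gamma>_def cayley_0 matrix_inv_mat_1)
    show "\<forall>\<^sub>F t in nhds 0. \<gamma> t \<in> orbit"
      using eventually_cayley_regular[of \<xi>]
      by (rule eventually_mono) (simp add: \<gamma>_def Sp_conj_orbit cayley_in_Sp \<xi>(1) \<eta>)
    have "(\<gamma> has_derivative (\<lambda>t. - (t *\<^sub>R (\<eta> ** \<xi>)) + t *\<^sub>R (\<xi> ** \<eta>))) (at 0)"
      unfolding \<gamma>_def
      using has_derivative_matrix_mul[OF has_derivative_matrix_mul[OF has_derivative_cayley has_derivative_const]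
          has_derivative_matrix_inv[OF has_derivative_cayley I], of \<xi> \<eta>]
      by (simp add: matrix_inv_mat_1 cayley_0 matrix_scalar_ac flip: scalar_matrix_assoc)
    then show "(\<gamma> has_derivative (\<lambda>t. t *\<^sub>R X)) (at 0)"
      by (simp add: \<xi>(2) commutator_def scaleR_diff_right)
  qed
qed

section \<open>The derivative of the coordinate\<close>

text \<open>Real and imaginary part of -b^-1 (a + i). In contrast to the eigenspace description of
  the coordinate, this is a smooth expression wherever the block b is invertible, an open condition,
  so it can be differentiated in all directions.\<close>

definition coord_extension :: "real^('n::finite + 'n)^('n + 'n) \<Rightarrow> complex^'n^'n" where
  "coord_extension \<eta> =
    complex_matrix (- (matrix_inv (block_ur \<eta>) ** block_ul \<eta>)) (- matrix_inv (block_ur \<eta>))"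

lemma
  assumes "W \<in> siegel"
  shows block_ul_orbit_point:
      "block_ul (orbit_point W) = matrix_inv (map_matrix Im W) ** map_matrix Re W"
    and matrix_inv_block_ur: "matrix_inv (block_ur (orbit_point W)) = - map_matrix Im W"
    and invertible_block_ur: "invertible (block_ur (orbit_point W))"
proof -
  show "block_ul (orbit_point W) = matrix_inv (map_matrix Im W) ** map_matrix Re W"
    by (simp add: orbit_point_def Let_def)
  have ur: "block_ur (orbit_point W) = - matrix_inv (map_matrix Im W)"
    by (simp add: orbit_point_def Let_def)
  have "invertible (map_matrix Im W)"
    using assms by (simp add: siegel_iff pos_def_invertible)
  then have *: "(- matrix_inv (map_matrix Im W)) ** (- map_matrix Im W) = mat 1"
    "(- map_matrix Im W) ** (- matrix_inv (map_matrix Im W)) = mat 1"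
    by (simp_all add: matrix_inv_left matrix_inv_right)
  show "matrix_inv (block_ur (orbit_point W)) = - map_matrix Im W"
    unfolding ur using *(1) by (rule matrix_inv_unique)
  show "invertible (block_ur (orbit_point W))"
    unfolding ur invertible_def using * by blast
qed

lemma coord_extension_orbit_point:
  assumes "W \<in> siegel"
  shows "coord_extension (orbit_point W) = W"
  using assms pos_def_invertible[of "map_matrix Im W"]
  by (simp add: coord_extension_def block_ul_orbit_point matrix_inv_block_ur siegel_iff
      matrix_mul_assoc matrix_inv_right complex_matrix_Re_Im)

lemma coord_extension_eq: "\<eta> \<in> orbit \<Longrightarrow> upper_half_coord \<eta> = coord_extension \<eta>"
  by (metis coord_extension_orbit_point orbit_is_orbit_point upper_half_coord_orbit_point)

lemma bounded_linear_block_ul: "bounded_linear (block_ul :: real^('n::finite + 'n)^('n + 'n) \<Rightarrow> _)"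
  and bounded_linear_block_ur: "bounded_linear (block_ur :: real^('n::finite + 'n)^('n + 'n) \<Rightarrow> _)"
  unfolding linear_conv_bounded_linear[symmetric]
  by (auto intro!: linearI simp: vec_eq_iff block_ul_def block_ur_def)

lemma bounded_linear_complex_matrix: "bounded_linear (\<lambda>p. complex_matrix (fst p) (snd p))"
  unfolding linear_conv_bounded_linear[symmetric]
  by (auto intro!: linearI simp: vec_eq_iff complex_eq_iff)

text \<open>At the base point b^-1 = -B, so the derivative of b^-1 in direction X is -B b' B, where
  a' and b' are the upper blocks of X. The imaginary part follows at once; the real part becomes B
  a' + B b' B a, and B a = A.\<close>

lemma has_derivative_coord_extension:
  assumes W: "W \<in> siegel"
  shows "(coord_extension has_derivative (\<lambda>X. complex_matrix
      (map_matrix Im W ** (block_ul X + block_ur X ** map_matrix Re W))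
      (map_matrix Im W ** block_ur X ** map_matrix Im W))) (at (orbit_point W))"
proof -
  let ?\<eta> = "orbit_point W"
  define A B where "A = map_matrix Re W" and "B = map_matrix Im W"
  have Bi: "B ** matrix_inv B = mat 1"
    using W by (simp add: B_def matrix_inv_right pos_def_invertible siegel_iff)
  have ul: "(block_ul has_derivative block_ul) (at ?\<eta>)" and ur: "(block_ur has_derivative block_ur) (at ?\<eta>)"
    by (simp_all add: bounded_linear_imp_has_derivative bounded_linear_block_ul bounded_linear_block_ur)
  have inv: "((\<lambda>X. matrix_inv (block_ur X)) has_derivative (\<lambda>X. - (B ** block_ur X ** B))) (at ?\<eta>)"
    using has_derivative_matrix_inv[OF ur invertible_block_ur[OF W]]
    by (simp add: matrix_inv_block_ur W flip: B_def)
  have Bul: "B ** block_ur X ** B ** block_ul ?\<eta> = B ** block_ur X ** A" for X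
    by (metis A_def B_def Bi W block_ul_orbit_point matrix_mul_assoc matrix_mul_lid)
  have re: "((\<lambda>X. - (matrix_inv (block_ur X) ** block_ul X)) has_derivative
      (\<lambda>X. B ** (block_ul X + block_ur X ** A))) (at ?\<eta>)"
    using has_derivative_minus[OF has_derivative_matrix_mul[OF inv ul]]
    by (simp add: matrix_inv_block_ur W matrix_add_ldistrib matrix_mul_assoc Bul add.commute flip: B_def)
  have im: "((\<lambda>X. - matrix_inv (block_ur X)) has_derivative (\<lambda>X. B ** block_ur X ** B)) (at ?\<eta>)"
    using has_derivative_minus[OF inv] by simp
  show ?thesis
    using bounded_linear.has_derivative[OF bounded_linear_complex_matrix has_derivative_Pair[OF re im]]
    by (simp add: coord_extension_def[abs_def] flip: A_def B_def)
qed

text \<open>Along a curve in the orbit with velocity X the coordinate and its extension coincide,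
  and a function of one real variable has only one derivative at 0. This fixes D X for every
  derivative D within the orbit.\<close>

lemma upper_half_coord_derivative_tangent:
  assumes W: "W \<in> siegel" and X: "X \<in> orbit_tangent (orbit_point W)"
    and D: "(upper_half_coord has_derivative D) (at (orbit_point W) within orbit)"
  shows "D X = complex_matrix
      (map_matrix Im W ** (block_ul X + block_ur X ** map_matrix Re W))
      (map_matrix Im W ** block_ur X ** map_matrix Im W)" (is "_ = ?F X")
proof -
  obtain \<gamma> where \<gamma>0: "\<gamma> 0 = orbit_point W" and \<gamma>: "(\<gamma> has_derivative (\<lambda>t. t *\<^sub>R X)) (at 0)"
    and orb: "\<forall>\<^sub>F t in nhds 0. \<gamma> t \<in> orbit"
    using orbit_curve[OF orbit_point_in_orbit[OF W] X] .
  \<comment> \<open>On an open U the curve stays in the orbit, so D may be composed with it, while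
    the derivative within U at 0 is still the ordinary, unique one.\<close>
  obtain U where U: "open U" "0 \<in> U" "\<And>t. t \<in> U \<Longrightarrow> \<gamma> t \<in> orbit"
    using orb by (auto simp: eventually_nhds)
  have at: "at 0 within U = at 0"
    by (rule at_within_open[OF U(2,1)])
  have "(upper_half_coord has_derivative D) (at (\<gamma> 0) within \<gamma> ` U)"
    unfolding \<gamma>0 using D by (rule has_derivative_subset) (use U(3) in blast)
  then have "((\<lambda>t. upper_half_coord (\<gamma> t)) has_derivative (\<lambda>t. D (t *\<^sub>R X))) (at 0 within U)"
    by (rule has_derivative_in_compose[OF \<gamma>[folded at]])
  then have "((\<lambda>t. coord_extension (\<gamma> t)) has_derivative (\<lambda>t. D (t *\<^sub>R X))) (at 0 within U)"
    by (rule has_derivative_transform[OF U(2), rotated]) (simp add: U(3) coord_extension_eq)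
  moreover have "((\<lambda>t. coord_extension (\<gamma> t)) has_derivative (\<lambda>t. ?F (t *\<^sub>R X))) (at 0)"
    by (rule has_derivative_compose[OF \<gamma>]) (unfold \<gamma>0, rule has_derivative_coord_extension[OF W])
  ultimately have "(\<lambda>t. D (t *\<^sub>R X)) = (\<lambda>t. ?F (t *\<^sub>R X))"
    unfolding at by (rule has_derivative_unique)
  then have "D (1 *\<^sub>R X) = ?F (1 *\<^sub>R X)"
    by (rule fun_cong)
  then show ?thesis
    by simp
qed

lemma upper_half_coord_differentiable:
  assumes "\<eta> \<in> orbit"
  shows "upper_half_coord differentiable (at \<eta> within orbit)"
proof -
  obtain W where W: "W \<in> siegel" "\<eta> = orbit_point W"
    using orbit_is_orbit_point[OF assms] .
  have "coord_extension differentiable (at \<eta> within orbit)"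
    using has_derivative_coord_extension[OF W(1)] W(2)
    by (meson differentiable_def differentiable_at_withinI)
  then show ?thesis
    unfolding differentiable_def
    by (meson assms coord_extension_eq has_derivative_transform)
qed

section \<open>The symplectic forms\<close>

lemma orbit_point_square:
  assumes "W \<in> siegel"
  shows "orbit_point W ** orbit_point W = - mat 1"
proof -
  define A B Bi where "A = map_matrix Re W" and "B = map_matrix Im W" and "Bi = matrix_inv B"
  have BBi: "B ** Bi = mat 1" "Bi ** B = mat 1"
    using assms by (simp_all add: Bi_def B_def matrix_inv_right matrix_inv_left siegel_iff
        pos_def_invertible)
  then have BBi': "X ** B ** Bi = X" "X ** Bi ** B = X" for X
    by (simp_all flip: matrix_mul_assoc)
  show ?thesis
    by (simp add: orbit_point_def Let_def block_matrix_mul block_matrix_1 block_matrix_minus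
        block_matrix_eq_iff matrix_add_ldistrib matrix_add_rdistrib matrix_mul_assoc BBi BBi'
        flip: A_def B_def Bi_def)
qed

text \<open>This removes the Lie algebra elements from the form. With Y = [\<zeta>, \<eta>], the
  anticommutation gives \<eta> X \<eta> = X, so both terms of Tr (X \<eta> Y) equal Tr (X \<zeta>),
  while the form itself is -1/2 Tr (X \<zeta>).\<close>

lemma kks_form_eq_trace:
  assumes sq: "\<eta> ** \<eta> = - mat 1" and X: "X \<in> orbit_tangent \<eta>" and Y: "Y \<in> orbit_tangent \<eta>"
  shows "kks_form \<eta> X Y = - 1/4 * trace (X ** \<eta> ** Y)"
    and "X ** \<eta> = - (\<eta> ** X)"
proof -
  obtain \<xi> \<zeta> where \<xi>: "\<xi> \<in> sp" "X = commutator \<xi> \<eta>" and \<zeta>: "\<zeta> \<in> sp" "Y = commutator \<zeta> \<eta>"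
    using X Y by (auto simp: orbit_tangent_def)
  have sq': "Z ** \<eta> ** \<eta> = - Z" for Z
    by (simp add: sq flip: matrix_mul_assoc)
  show anti: "X ** \<eta> = - (\<eta> ** X)"
    by (simp add: \<xi>(2) commutator_def matrix_diff_ldistrib matrix_diff_rdistrib matrix_mul_assoc sq sq')
  have "trace (X ** \<eta> ** Y) = trace (X ** \<eta> ** \<zeta> ** \<eta>) + trace (X ** \<zeta>)"
    by (simp add: \<zeta>(2) commutator_def matrix_diff_ldistrib matrix_mul_assoc sq' trace_add)
  also have "trace (X ** \<eta> ** \<zeta> ** \<eta>) = trace (\<eta> ** (X ** \<eta>) ** \<zeta>)"
    by (metis matrix_mul_assoc trace_mul_sym)
  also have "\<eta> ** (X ** \<eta>) = X"
    by (simp add: anti matrix_mul_assoc sq)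
  finally have "trace (X ** \<eta> ** Y) = 2 * trace (X ** \<zeta>)"
    by simp
  then show "kks_form \<eta> X Y = - 1/4 * trace (X ** \<eta> ** Y)"
    by (simp add: \<xi> \<zeta> kks_form_commutator trace_form_commutator_left) (simp add: trace_form_def)
qed

text \<open>Conjugating by the shear moves \<open>W\<close> to \<open>i B\<close>; there \<open>\<eta>\<close> has vanishing diagonal blocks, and
  anticommuting with it determines the lower blocks of a tangent vector.\<close>

lemma trace_orbit_point_anticommuting:
  fixes X Y :: "real^('n::finite + 'n)^('n + 'n)"
  assumes W: "W \<in> siegel"
    and X: "X ** orbit_point W = - (orbit_point W ** X)"
    and Y: "Y ** orbit_point W = - (orbit_point W ** Y)"
  defines "A \<equiv> map_matrix Re W" and "B \<equiv> map_matrix Im W"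
  shows "trace (X ** orbit_point W ** Y) =
    2 * trace (block_ur X ** B ** (block_ul Y + block_ur Y ** A))
    - 2 * trace ((block_ul X + block_ur X ** A) ** block_ur Y ** B)"
proof -
  define Bi where "Bi = matrix_inv B"
  have BBi: "B ** Bi = mat 1" "Bi ** B = mat 1"
    using W by (simp_all add: Bi_def B_def matrix_inv_right matrix_inv_left siegel_iff
        pos_def_invertible)
  have BBi': "Z ** B ** Bi = Z" "Z ** Bi ** B = Z" for Z
    using BBi by (simp_all flip: matrix_mul_assoc)
  define T Ti where "T = block_matrix (mat 1) 0 (- A) (mat 1)"
    and "Ti = block_matrix (mat 1) 0 A (mat 1)"
  have TiT: "Ti ** T = mat 1"
    by (simp add: T_def Ti_def block_matrix_mul block_matrix_1)
  define K where "K = block_matrix 0 (- Bi) B 0"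
  have K: "T ** orbit_point W ** Ti = K"
    by (simp add: T_def Ti_def K_def orbit_point_def Let_def block_matrix_mul block_matrix_eq_iff
        matrix_add_ldistrib matrix_add_rdistrib matrix_mul_assoc flip: A_def B_def Bi_def)
  have conj_mul: "(T ** M ** Ti) ** (T ** N ** Ti) = T ** (M ** N) ** Ti" for M N
  proof -
    have "(T ** M ** Ti) ** (T ** N ** Ti) = T ** M ** (Ti ** T) ** N ** Ti"
      by (simp only: matrix_mul_assoc)
    then show ?thesis
      by (simp add: TiT matrix_mul_assoc)
  qed
  have trace_conj: "trace (T ** M ** Ti) = trace M" for M
    by (simp add: trace_mul_cycle[of T] matrix_mul_assoc TiT)
  have shape: "T ** Z ** Ti = block_matrix (block_ul Z + block_ur Z ** A) (block_ur Z)
      (B ** block_ur Z ** B) (- (B ** (block_ul Z + block_ur Z ** A) ** Bi))"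
    if Z: "Z ** orbit_point W = - (orbit_point W ** Z)" for Z
  proof -
    obtain a b c d where abcd: "Z = block_matrix a b c d"
      by (rule block_matrix_exhaust)
    define p r s where "p = a + b ** A" and "r = - A ** p + c + d ** A" and "s = - A ** b + d"
    have TZ: "T ** Z ** Ti = block_matrix p b r s"
      by (simp add: T_def Ti_def abcd block_matrix_mul block_matrix_eq_iff p_def r_def s_def
          matrix_diff_rdistrib matrix_add_ldistrib matrix_add_rdistrib matrix_mul_assoc)
    have "(T ** Z ** Ti) ** K = - (K ** (T ** Z ** Ti))"
      by (simp add: K[symmetric] conj_mul Z)
    \<comment> \<open>The first block column of the anticommutation with K suffices; the second one
      carries the same two equations.\<close>
    then have e: "b ** B = Bi ** r" "s ** B = - (B ** p)"
      by (simp_all add: TZ K_def block_matrix_mul block_matrix_minus block_matrix_eq_iff)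
    have "r = B ** b ** B"
      using arg_cong[OF e(1), of "(**) B"] by (simp add: matrix_mul_assoc BBi)
    moreover have "s = - (B ** p ** Bi)"
      using arg_cong[OF e(2), of "\<lambda>M. M ** Bi"] by (simp add: BBi')
    ultimately show ?thesis
      using TZ by (simp add: abcd p_def)
  qed
  define p q p' q' where "p = block_ul X + block_ur X ** A" and "q = block_ur X"
    and "p' = block_ul Y + block_ur Y ** A" and "q' = block_ur Y"
  have "trace (X ** orbit_point W ** Y) = trace ((T ** X ** Ti) ** K ** (T ** Y ** Ti))"
    by (simp add: K[symmetric] conj_mul trace_conj)
  also have "\<dots> = trace (q ** B ** p') - trace (p ** q' ** B)
      - trace (B ** p ** q') + trace (B ** q ** B ** p' ** Bi)"
    unfolding shape[OF X, folded p_def q_def] shape[OF Y, folded p'_def q'_def]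
    by (simp add: K_def block_matrix_mul trace_block_matrix trace_add trace_minus matrix_mul_assoc
        BBi BBi' trace_sub)
  \<comment> \<open>Cyclicity identifies the four traces in pairs, which produces the factor
    2.\<close>
  also have "trace (B ** p ** q') = trace (p ** q' ** B)"
    by (metis matrix_mul_assoc trace_mul_sym)
  also have "trace (B ** q ** B ** p' ** Bi) = trace (q ** B ** p')"
    by (metis BBi(2) matrix_mul_assoc trace_mul_sym matrix_mul_lid)
  finally show ?thesis
    by (simp add: p_def q_def p'_def q'_def)
qed

text \<open>The arguments have the shape in which the derivative of the coordinate delivers them,
  with real part B P and imaginary part B Q B, so that the leading B cancels against every B^-1 of
  the form.\<close>

lemma siegel_form_complex_matrix:
  fixes W :: "complex^'n^'n"
  assumes "W \<in> siegel"
  defines "B \<equiv> map_matrix Im W"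
  shows "siegel_form W (complex_matrix (B ** P) (B ** Q ** B)) (complex_matrix (B ** P') (B ** Q' ** B)) =
    trace (P ** Q' ** B) - trace (Q ** B ** P')"
proof -
  have "matrix_inv B ** B = mat 1"
    using assms by (simp add: matrix_inv_left siegel_iff pos_def_invertible)
  then have "Z ** matrix_inv B ** B = Z" for Z :: "real^'n^'n"
    by (simp flip: matrix_mul_assoc)
  then show ?thesis
    using \<open>matrix_inv B ** B = mat 1\<close>
    by (simp add: siegel_form_def Let_def trace_sub matrix_mul_assoc flip: B_def)
qed

text \<open>The identification of the two forms is a pullback: tangent vectors are pushed forward by
  D. Differentiability is asserted separately so that the quantification over D is not vacuous, and
  all derivatives D within the orbit agree on the tangent vectors considered.\<close>

theorem mainTheorem5:
  shows "bij_betw upper_half_coord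
           (orbit :: (real^('n::finite + 'n)^('n + 'n)) set) (siegel :: (complex^'n^'n) set)
    \<and> (\<forall>\<eta>\<in>(orbit :: (real^('n + 'n)^('n + 'n)) set).
        minus_i_eigenspace \<eta> = graph_space (upper_half_coord \<eta>)
      \<and> upper_half_coord differentiable (at \<eta> within orbit)
      \<and> (\<forall>D. (upper_half_coord has_derivative D) (at \<eta> within orbit) \<longrightarrow>
           (\<forall>X\<in>orbit_tangent \<eta>. \<forall>Y\<in>orbit_tangent \<eta>.
              kks_form \<eta> X Y = 1/2 * siegel_form (upper_half_coord \<eta>) (D X) (D Y))))"
proof (intro conjI ballI allI impI)
  show "bij_betw upper_half_coord (orbit :: (real^('n + 'n)^('n + 'n)) set) siegel"
    by (rule bij_betw_upper_half_coord)
next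
  fix \<eta> :: "real^('n + 'n)^('n + 'n)"
  assume \<eta>: "\<eta> \<in> orbit"
  then obtain W where W: "W \<in> siegel" "\<eta> = orbit_point W"
    by (rule orbit_is_orbit_point)
  show "minus_i_eigenspace \<eta> = graph_space (upper_half_coord \<eta>)"
    using W by (simp add: minus_i_eigenspace_orbit_point upper_half_coord_orbit_point)
  show "upper_half_coord differentiable (at \<eta> within orbit)"
    using \<eta> by (rule upper_half_coord_differentiable)
  fix D X Y
  assume D: "(upper_half_coord has_derivative D) (at \<eta> within orbit)"
    and X: "X \<in> orbit_tangent \<eta>" and Y: "Y \<in> orbit_tangent \<eta>"
  have sq: "\<eta> ** \<eta> = - mat 1"
    using W by (simp add: orbit_point_square)
  have anti: "X ** \<eta> = - (\<eta> ** X)" "Y ** \<eta> = - (\<eta> ** Y)"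
    using kks_form_eq_trace(2)[OF sq] X Y by blast+
  \<comment> \<open>Let Q, Q' be the upper right blocks of X, Y, and let P, P' be their upper left
    blocks corrected by Q A, Q' A. Then the left side is -1/4 times 2 (Tr (Q B P') - Tr (P Q' B)),
    which is half of Tr (P Q' B) - Tr (Q B P').\<close>
  show "kks_form \<eta> X Y = 1/2 * siegel_form (upper_half_coord \<eta>) (D X) (D Y)"
    unfolding kks_form_eq_trace(1)[OF sq X Y] trace_orbit_point_anticommuting[OF W(1) anti[unfolded W(2)], folded W(2)]
    using upper_half_coord_derivative_tangent[OF W(1) X[unfolded W(2)] D[unfolded W(2)]]
      upper_half_coord_derivative_tangent[OF W(1) Y[unfolded W(2)] D[unfolded W(2)]]
    by (simp add: W upper_half_coord_orbit_point siegel_form_complex_matrix field_simps)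
qed

end
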